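(* For all $\phi\in C^\infty(B_R)$, we have $$\left(\int_{B_R}|\nabla\phi|^2\,dx\right)\left(\int_{B_R}|x|^2\phi^2\,dx\right)\ \ge\ \frac14\left(n\int_{B_R}\phi^2\,dx-R^2\int_{\partial B_R}\phi^2\,d\nu\right)^2.$$
   Context: $B_R=\{x\in\mathbb{R}^n:|x|<R\}$ is the open ball of radius $R$ centered at the origin, $\partial B_R=\{x\in\mathbb{R}^n:|x|=R\}$ is its boundary sphere, and $d\nu$ is the surface measure on $\partial B_R$.
   Formalization: The coefficient R² of the boundary integral is corrected to R (the printed form fails for φ = 1, n = 1, R = 2), and φ, smooth on the open ball, is assumed continuous on the closed ball so that the boundary integral makes sense. *)

theory Defs
  imports "HOL-Analysis.Analysis"
begin

text \<open>\<open>iter_differentiable_on S f k\<close>: all iterated directional derivatives of \<open>f\<close> of order at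
  most \<open>k\<close> exist and are continuous on \<open>S\<close>.  Only meaningful for open \<open>S\<close>.\<close>

fun iter_differentiable_on ::
  "'a::real_normed_vector set \<Rightarrow> ('a \<Rightarrow> 'b::real_normed_vector) \<Rightarrow> nat \<Rightarrow> bool" where
  "iter_differentiable_on S f 0 \<longleftrightarrow> continuous_on S f"
| "iter_differentiable_on S f (Suc k) \<longleftrightarrow>
     (\<forall>x\<in>S. f differentiable at x) \<and>
     (\<forall>v. iter_differentiable_on S (\<lambda>x. frechet_derivative f (at x) v) k)"

definition C_infinity_on ::
  "'a::real_normed_vector set \<Rightarrow> ('a \<Rightarrow> 'b::real_normed_vector) \<Rightarrow> bool" where
  "C_infinity_on S f \<longleftrightarrow> (\<forall>k. iter_differentiable_on S f k)"

definition gradient :: "('a::real_inner \<Rightarrow> real) \<Rightarrow> 'a \<Rightarrow> 'a" where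
  "gradient f x = (THE D. GDERIV f x :> D)"

text \<open>Surface measure on \<open>sphere 0 R\<close>, normalised as the usual \<open>(n - 1)\<close>-dimensional area
  (counting measure for \<open>n = 1\<close>).  It is the cone construction of polar coordinates:
  \<open>A\<close> gets \<open>n / R\<close> times the Lebesgue measure of the cone
  \<open>{x. norm x < R \<and> (R / norm x) *\<^sub>R x \<in> A}\<close> over \<open>A\<close>.  The measure lives on the Borel sets of the
  whole space and is carried by the sphere.\<close>

definition sphere_measure :: "real \<Rightarrow> 'a::euclidean_space measure" where
  "sphere_measure R =
     distr (density lborel (\<lambda>x. ennreal (real DIM('a) / R) * indicator (ball 0 R) x))
       borel (\<lambda>x. (R / norm x) *\<^sub>R x)"

lemma sets_sphere_measure [simp, measurable_cong]: "sets (sphere_measure R) = sets borel"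
  by (simp add: sphere_measure_def)

lemma space_sphere_measure [simp]: "space (sphere_measure R) = UNIV"
  by (simp add: sphere_measure_def)

lemma emeasure_sphere_measure:
  fixes A :: "'a::euclidean_space set"
  assumes A [measurable]: "A \<in> sets borel"
  shows "emeasure (sphere_measure R) A =
    ennreal (real DIM('a) / R) * emeasure lborel {x. norm x < R \<and> (R / norm x) *\<^sub>R x \<in> A}"
proof -
  let ?p = "\<lambda>x::'a. (R / norm x) *\<^sub>R x"
  let ?d = "\<lambda>x::'a. ennreal (real DIM('a) / R) * indicator (ball 0 R) x"
  have [measurable]: "?p \<in> borel \<rightarrow>\<^sub>M borel" by measurable
  have [measurable]: "ball (0::'a) R \<in> sets borel" by simp
  have [measurable]: "?d \<in> borel_measurable borel" by measurable
  have B: "?p -` A \<in> sets borel"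
    using measurable_sets[OF \<open>?p \<in> borel \<rightarrow>\<^sub>M borel\<close> A] by simp
  have "emeasure (sphere_measure R) A = emeasure (density lborel ?d) (?p -` A)"
    unfolding sphere_measure_def by (subst emeasure_distr) auto
  also have "\<dots> = (\<integral>\<^sup>+x. ?d x * indicator (?p -` A) x \<partial>lborel)"
    using B by (subst emeasure_density) auto
  also have "\<dots> = (\<integral>\<^sup>+x. ennreal (real DIM('a) / R) * indicator (ball 0 R \<inter> ?p -` A) x \<partial>lborel)"
    by (intro nn_integral_cong) (auto simp: indicator_def)
  also have "\<dots> = ennreal (real DIM('a) / R) * emeasure lborel (ball 0 R \<inter> ?p -` A)"
    using B by (subst nn_integral_cmult_indicator) auto
  also have "ball 0 R \<inter> ?p -` A = {x. norm x < R \<and> ?p x \<in> A}"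
    by auto
  finally show ?thesis .
qed

lemma emeasure_sphere_measure_outside:
  assumes "R > 0"
  shows "emeasure (sphere_measure R) (- sphere (0::'a::euclidean_space) R) = 0"
proof -
  have "{x::'a. norm x < R \<and> (R / norm x) *\<^sub>R x \<in> - sphere 0 R} = {0}"
    using assms by auto
  then show ?thesis
    by (subst emeasure_sphere_measure) auto
qed

lemma emeasure_sphere_measure_total:
  assumes "R > 0"
  shows "emeasure (sphere_measure R) (sphere (0::'a::euclidean_space) R) =
    ennreal (real DIM('a) * unit_ball_vol DIM('a) * R ^ (DIM('a) - 1))"
proof -
  have "{x::'a. norm x < R \<and> (R / norm x) *\<^sub>R x \<in> sphere 0 R} = ball 0 R - {0}"
    using assms by auto
  moreover have "emeasure lborel (ball (0::'a) R - {0}) = emeasure lborel (ball (0::'a) R)"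
    using assms by (subst emeasure_Diff) auto
  moreover have "real DIM('a) / R * (unit_ball_vol DIM('a) * R ^ DIM('a)) =
      real DIM('a) * unit_ball_vol DIM('a) * R ^ (DIM('a) - 1)"
    using assms by (simp add: power_eq_if[of R "DIM('a)"])
  ultimately show ?thesis
    using assms emeasure_ball[of R "0::'a"]
    by (simp add: emeasure_sphere_measure flip: ennreal_mult')
qed

end

theory Submission
  imports Defs
begin

text \<open>The divergence theorem for the field \<open>(\<phi> x)\<^sup>2 *\<^sub>R x\<close> on a ball of radius \<open>r\<close>, followed by the
  Cauchy-Schwarz inequality for \<open>\<integral>\<phi> x * (x \<bullet> gradient \<phi> x)\<close>.  The gradient need not be integrable
  up to the boundary, so this is done for \<open>r < R\<close>; the left-hand side is monotone in \<open>r\<close>, and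
  \<open>r \<rightarrow> R\<close> by dominated convergence, \<open>\<phi>\<close> being bounded on the closed ball.\<close>

section \<open>Scaling of Lebesgue measure and the divergence theorem for fields
  \<open>f x *\<^sub>R x\<close>\<close>

lemma lborel_integral_scaleR:
  fixes h :: "'a::euclidean_space \<Rightarrow> real"
  assumes [measurable]: "h \<in> borel_measurable borel" and "c \<noteq> 0"
  shows "(\<integral>x. h (c *\<^sub>R x) \<partial>lborel) = (\<integral>x. h x \<partial>lborel) / \<bar>c\<bar> ^ DIM('a)"
proof -
  have "(\<integral>x. h x \<partial>lborel) =
      (\<integral>x. h x \<partial>density (distr lborel borel (\<lambda>x::'a. 0 + c *\<^sub>R x)) (\<lambda>_. ennreal (\<bar>c\<bar> ^ DIM('a))))"
    using lborel_affine[OF \<open>c \<noteq> 0\<close>, of "0::'a"] by (simp add: ennreal_power)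
  also have "\<dots> = \<bar>c\<bar> ^ DIM('a) * (\<integral>x. h (c *\<^sub>R x) \<partial>lborel)"
    by (subst integral_density) (auto simp: integral_distr)
  finally show ?thesis
    using \<open>c \<noteq> 0\<close> by simp
qed

lemma lborel_integrable_scaleR:
  fixes h :: "'a::euclidean_space \<Rightarrow> real"
  assumes h: "integrable lborel h" and "c \<noteq> 0"
  shows "integrable lborel (\<lambda>x. h (c *\<^sub>R x))"
proof -
  have [measurable]: "h \<in> borel_measurable borel"
    using h by (simp add: borel_measurable_integrable)
  have "integrable (density (distr lborel borel (\<lambda>x::'a. 0 + c *\<^sub>R x)) (\<lambda>_. ennreal (\<bar>c\<bar> ^ DIM('a)))) h"
    using h lborel_affine[OF \<open>c \<noteq> 0\<close>, of "0::'a"] by (simp add: ennreal_power)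
  then show ?thesis
    using \<open>c \<noteq> 0\<close> by (subst (asm) integrable_density) (auto simp: integrable_distr_eq)
qed

text \<open>The antiderivative is \<open>- 1 / (n * s ^ n)\<close>. This integral is the source of
  the factor 1/n when rays are averaged: n powers of s come from the Jacobian of a dilation, and one
  more from the factor \<open>1 / s\<close> in the integrand.\<close>

lemma has_bochner_integral_inverse_power_atLeast:
  fixes n :: nat
  assumes "n > 0"
  shows "has_bochner_integral lborel (\<lambda>s::real. indicator {1..} s * (1 / s ^ Suc n)) (1 / n)"
proof (rule has_bochner_integral_nn_integral)
  have "(\<integral>\<^sup>+s. ennreal (1 / s ^ Suc n) * indicator {1..} s \<partial>lborel) = ennreal (0 - (- 1 / (real n * 1 ^ n)))"
  proof (rule nn_integral_FTC_atLeast[where F = "\<lambda>s. - 1 / (n * s ^ n)"])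
    fix s :: real assume "1 \<le> s"
    then show "((\<lambda>s. - 1 / (n * s ^ n)) has_real_derivative 1 / s ^ Suc n) (at s)"
      using assms
      by (auto intro!: derivative_eq_intros simp: divide_simps power_eq_if[of s n])
  next
    show "((\<lambda>s::real. - 1 / (n * s ^ n)) \<longlongrightarrow> 0) at_top"
      using assms
      by (intro tendsto_divide_0[OF tendsto_const] filterlim_at_top_imp_at_infinity
          filterlim_tendsto_pos_mult_at_top[OF tendsto_const] filterlim_pow_at_top filterlim_ident) auto
  qed auto
  moreover have "(\<integral>\<^sup>+s. ennreal (indicator {1..} s * (1 / s ^ Suc n)) \<partial>lborel) =
      (\<integral>\<^sup>+s. ennreal (1 / s ^ Suc n) * indicator {1..} s \<partial>lborel)"
    by (intro nn_integral_cong) (simp add: indicator_def)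
  ultimately show "(\<integral>\<^sup>+s. ennreal (indicator {1..} s * (1 / s ^ Suc n)) \<partial>lborel) = ennreal (1 / n)"
    by simp
qed (auto simp: indicator_def)

text \<open>With \<open>h x = x \<bullet> g x\<close>, the fundamental theorem of calculus along the ray from \<open>x\<close> to
  \<open>(r / norm x) *\<^sub>R x\<close> gives \<open>f ((r / norm x) *\<^sub>R x) - f x = (\<integral>s\<in>{1..r / norm x}. h (s *\<^sub>R x) / s)\<close>.
  Integrating over the ball and exchanging the integrals, the substitution \<open>y = s *\<^sub>R x\<close> turns the
  right-hand side into \<open>(\<integral>s\<in>{1..}. 1 / s ^ (n + 1)) * (\<integral>h) = (\<integral>h) / n\<close>.\<close>

lemma radial_divergence_theorem:
  fixes f :: "'a::euclidean_space \<Rightarrow> real"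
  assumes r: "0 < r" "r < R"
    and f: "\<And>x. x \<in> ball 0 R \<Longrightarrow> GDERIV f x :> g x"
    and g: "continuous_on (ball 0 R) g"
  shows "(LINT x:cball 0 r|lborel. x \<bullet> g x) =
    DIM('a) * (LINT x:cball 0 r|lborel. f ((r / norm x) *\<^sub>R x)) - DIM('a) * (LINT x:cball 0 r|lborel. f x)"
proof -
  have cball: "cball 0 r \<subseteq> ball (0::'a) R"
    using r by auto
  have contf: "continuous_on (ball 0 R) f"
    using f unfolding gderiv_def
    by (blast intro: continuous_at_imp_continuous_on has_derivative_continuous)
  \<comment> \<open>The cut-off in \<open>h\<close> makes the ray integral stop by itself at s = r /
    norm x, so s can range over all of \<open>{1..}\<close>, independently of x.\<close>
  define h where "h x = indicator (cball 0 r) x *\<^sub>R (x \<bullet> g x)" for x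
  have hint: "integrable lborel h"
    unfolding h_def
    by (intro borel_integrable_compact continuous_intros continuous_on_subset[OF g cball]) auto
  have hm [measurable]: "h \<in> borel_measurable borel"
    using hint by (simp add: borel_measurable_integrable)
  define K where "K s x = indicator {1..} s * (h (s *\<^sub>R x) / s)" for s :: real and x
  have Km: "case_prod K \<in> borel_measurable (lborel \<Otimes>\<^sub>M lborel)"
    unfolding K_def by measurable
  have scale: "(\<integral>x. u (s *\<^sub>R x) / s * indicator {1..} s \<partial>lborel) =
      (\<integral>x. u x \<partial>lborel) * (indicator {1..} s * (1 / s ^ Suc DIM('a)))"
    if [measurable]: "u \<in> borel_measurable borel" for s :: real and u :: "'a \<Rightarrow> real"
    using lborel_integral_scaleR[OF that, of s] by (cases "s \<ge> 1") auto
  have pow: "has_bochner_integral lborel (\<lambda>s::real. indicator {1..} s * (1 / s ^ Suc DIM('a))) (1 / DIM('a))"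
    by (rule has_bochner_integral_inverse_power_atLeast) simp
  have Kint: "integrable (lborel \<Otimes>\<^sub>M lborel) (case_prod K)"
  \<comment> \<open>Scaling applied to the absolute value of \<open>h\<close> bounds the mass of
    each slice by a constant times \<open>1 / s ^ Suc n\<close> with n the dimension, which is
    integrable on \<open>{1..}\<close>.\<close>
  proof (rule lborel_pair.Fubini_integrable[OF Km])
    have "(\<integral>x. norm (case_prod K (s, x)) \<partial>lborel) =
        (\<integral>x. \<bar>h x\<bar> \<partial>lborel) * (indicator {1..} s * (1 / s ^ Suc DIM('a)))" for s
    proof -
      have "norm (case_prod K (s, x)) = \<bar>h (s *\<^sub>R x)\<bar> / s * indicator {1..} s" for x
        by (simp add: K_def indicator_def)
      then show ?thesis
        using scale[of "\<lambda>x. \<bar>h x\<bar>" s] by simp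
    qed
    then show "integrable lborel (\<lambda>s. \<integral>x. norm (case_prod K (s, x)) \<partial>lborel)"
      using pow by (simp only: integrable_mult_right has_bochner_integral_iff)
    show "AE s in lborel. integrable lborel (\<lambda>x. case_prod K (s, x))"
      using lborel_integrable_scaleR[OF hint]
      by (intro AE_I2) (auto simp: K_def indicator_def)
  qed
  have inner_s: "(\<integral>s. K s x \<partial>lborel) =
      indicator (cball 0 r) x *\<^sub>R (f ((r / norm x) *\<^sub>R x) - f x)" for x
  \<comment> \<open>Outside the closed ball, dilation by s \<ge> 1 stays outside. At the origin
    division by zero gives r / 0 = 0, so the projected point is the origin too and both sides
    vanish.\<close>
  proof (cases "x = 0 \<or> x \<notin> cball 0 r")
    case True
    then have "K s x = 0" for s
    proof (cases "s \<ge> 1")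
      case s: True
      have "norm x \<le> s * norm x"
        using s by (simp add: mult_le_cancel_right1)
      with True s show ?thesis
        by (auto simp: K_def h_def indicator_def)
    qed (simp add: K_def)
    with True show ?thesis
      by auto
  next
    case False
    let ?b = "r / norm x"
    have b: "1 \<le> ?b" and x: "x \<noteq> 0" "norm x \<le> r"
      using False by (auto simp: field_simps)
    have in_cball: "s *\<^sub>R x \<in> cball 0 r" if "s \<in> {1..?b}" for s
      using that x by (simp add: field_simps)
    have "(\<integral>s. indicator {1..?b} s *\<^sub>R (x \<bullet> g (s *\<^sub>R x)) \<partial>lborel) = f (?b *\<^sub>R x) - f (1 *\<^sub>R x)"
    proof (rule integral_FTC_Icc[OF b])
      fix s assume "1 \<le> s" "s \<le> ?b"
      then have "s *\<^sub>R x \<in> ball 0 R"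
        using in_cball cball by (meson atLeastAtMost_iff subsetD)
      then have "(f has_derivative (\<lambda>v. v \<bullet> g (s *\<^sub>R x))) (at (s *\<^sub>R x))"
        using f by (simp add: gderiv_def)
      moreover have "((\<lambda>s. s *\<^sub>R x) has_derivative (\<lambda>t. t *\<^sub>R x)) (at s within {1..?b})"
        by (auto intro!: derivative_eq_intros)
      ultimately have "((\<lambda>s. f (s *\<^sub>R x)) has_derivative (\<lambda>t. (t *\<^sub>R x) \<bullet> g (s *\<^sub>R x))) (at s within {1..?b})"
        by (rule has_derivative_compose[rotated])
      then show "((\<lambda>s. f (s *\<^sub>R x)) has_vector_derivative x \<bullet> g (s *\<^sub>R x)) (at s within {1..?b})"
        by (simp add: has_vector_derivative_def)
    next
      show "continuous_on {1..?b} (\<lambda>s. x \<bullet> g (s *\<^sub>R x))"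
        using in_cball cball
        by (intro continuous_intros continuous_on_compose2[OF g]) blast
    qed
    \<comment> \<open>Homogeneity of the inner product: the s from
      \<open>(s *\<^sub>R x) \<bullet> g (s *\<^sub>R x)\<close> cancels the division by s in
      \<open>K\<close>.\<close>
    moreover have "K s x = indicator {1..?b} s *\<^sub>R (x \<bullet> g (s *\<^sub>R x))" for s
      using x by (auto simp: K_def h_def indicator_def field_simps)
    ultimately show ?thesis
      using x by simp
  qed
  \<comment> \<open>Nothing is known about \<open>f\<close> outside the open ball. Its extension by
    zero is Borel and agrees with \<open>f\<close> at every projected point, which makes the
    composition with the projection measurable.\<close>
  define F where "F x = indicator (ball 0 R) x *\<^sub>R f x" for x
  have Fm [measurable]: "F \<in> borel_measurable borel"
    unfolding F_def by (intro borel_measurable_continuous_on_indicator contf) simp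
  have proj: "(r / norm x) *\<^sub>R x \<in> cball 0 r" for x :: 'a
    using r by (cases "x = 0") auto
  have Fproj: "F ((r / norm x) *\<^sub>R x) = f ((r / norm x) *\<^sub>R x)" for x
    using subsetD[OF cball proj[of x]] by (simp add: F_def)
  obtain B where B: "\<And>x. x \<in> cball 0 r \<Longrightarrow> norm (f x) \<le> B"
  proof -
    obtain B where "\<forall>y\<in>f ` cball 0 r. norm y \<le> B"
      using compact_imp_bounded[OF compact_continuous_image[OF continuous_on_subset[OF contf cball] compact_cball]]
      unfolding bounded_iff by blast
    then show ?thesis
      by (intro that[of B]) blast
  qed
  have int1: "set_integrable lborel (cball 0 r) (\<lambda>x. f ((r / norm x) *\<^sub>R x))"
    unfolding set_integrable_def
  proof (rule integrableI_bounded_set_indicator[where B = B])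
    have "(\<lambda>x. F ((r / norm x) *\<^sub>R x)) \<in> borel_measurable borel"
      by (rule measurable_compose[OF _ Fm]) measurable
    then show "(\<lambda>x. f ((r / norm x) *\<^sub>R x)) \<in> borel_measurable lborel"
      by (simp add: Fproj)
    show "emeasure lborel (cball (0::'a) r) < \<infinity>"
      using emeasure_bounded_finite[OF bounded_cball] by simp
  qed (use B[OF proj] in simp_all)
  have int2: "set_integrable lborel (cball 0 r) f"
    unfolding set_integrable_def
    by (intro borel_integrable_compact continuous_on_subset[OF contf cball]) auto
  have "(\<integral>x. h x \<partial>lborel) / DIM('a) = (\<integral>s. \<integral>x. K s x \<partial>lborel \<partial>lborel)"
  proof -
    have "(\<integral>x. K s x \<partial>lborel) = (\<integral>x. h x \<partial>lborel) * (indicator {1..} s * (1 / s ^ Suc DIM('a)))" for s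
      using scale[OF hm, of s] by (simp add: K_def mult.commute)
    then show ?thesis
      using has_bochner_integral_integral_eq[OF pow] by (simp only: integral_mult_right_zero) simp
  qed
  also have "\<dots> = (\<integral>x. \<integral>s. K s x \<partial>lborel \<partial>lborel)"
    by (rule lborel_pair.Fubini_integral[OF Kint, symmetric])
  also have "\<dots> = (LINT x:cball 0 r|lborel. f ((r / norm x) *\<^sub>R x) - f x)"
    by (simp add: inner_s set_lebesgue_integral_def)
  also have "\<dots> = (LINT x:cball 0 r|lborel. f ((r / norm x) *\<^sub>R x)) - (LINT x:cball 0 r|lborel. f x)"
    using int1 int2 by (rule set_integral_diff)
  finally show ?thesis
    by (simp add: h_def[abs_def] set_lebesgue_integral_def field_simps)
qed

section \<open>Gradients of smooth functions\<close>

lemma gradient_eqI: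
  assumes "GDERIV f x :> D"
  shows "gradient f x = D"
  unfolding gradient_def
proof (rule the_equality)
  show "GDERIV f x :> D"
    by (rule assms)
next
  fix E assume "GDERIV f x :> E"
  then have "(\<lambda>h. h \<bullet> E) = (\<lambda>h. h \<bullet> D)"
    using assms unfolding gderiv_def by (rule has_derivative_unique)
  then have "\<forall>h. h \<bullet> E = h \<bullet> D"
    by (simp add: fun_eq_iff)
  then show "E = D"
    by (rule vector_eq_ldot[THEN iffD1])
qed

text \<open>Order one of the smoothness hierarchy gives continuous directional derivatives.
  Assembling those along the basis into a vector yields the gradient, because a linear form is
  determined by its values on the basis.\<close>

lemma C_infinity_on_gradient:
  fixes f :: "'a::euclidean_space \<Rightarrow> real"
  assumes "C_infinity_on S f" "open S"
  shows GDERIV_gradient_C_infinity_on: "x \<in> S \<Longrightarrow> GDERIV f x :> gradient f x"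
    and continuous_on_gradient_C_infinity_on: "continuous_on S (gradient f)"
proof -
  let ?G = "\<lambda>x. \<Sum>b\<in>Basis. frechet_derivative f (at x) b *\<^sub>R b"
  have *: "iter_differentiable_on S f (Suc 0)"
    using assms unfolding C_infinity_on_def by blast
  have G: "GDERIV f x :> ?G x" if "x \<in> S" for x
  proof -
    have d: "(f has_derivative frechet_derivative f (at x)) (at x)"
      using * that frechet_derivative_works by auto
    then interpret linear "frechet_derivative f (at x)"
      by (rule has_derivative_linear)
    have "frechet_derivative f (at x) v = v \<bullet> ?G x" for v
    proof -
      have "frechet_derivative f (at x) v = frechet_derivative f (at x) (\<Sum>b\<in>Basis. (v \<bullet> b) *\<^sub>R b)"
        by (simp add: euclidean_representation)
      then show ?thesis
        by (simp add: sum scaleR inner_sum_right mult.commute)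
    qed
    then have "frechet_derivative f (at x) = (\<lambda>v. v \<bullet> ?G x)"
      by blast
    then show ?thesis
      using d unfolding gderiv_def by simp
  qed
  show "x \<in> S \<Longrightarrow> GDERIV f x :> gradient f x"
    using G gradient_eqI by metis
  have "continuous_on S ?G"
    using * by (intro continuous_intros) auto
  then show "continuous_on S (gradient f)"
    using G gradient_eqI by (metis (no_types, lifting) continuous_on_cong)
qed

section \<open>Surface integrals as integrals over the ball\<close>

text \<open>This is the change of variables for the push-forward that defines the surface measure;
  the factor R clears the denominator of the density n / R.\<close>

lemma set_integral_sphere_measure:
  fixes f :: "'a::euclidean_space \<Rightarrow> real"
  assumes "R > 0" "continuous_on (sphere 0 R) f"
  shows "R * (LINT x:sphere 0 R|sphere_measure R. f x) =
    DIM('a) * (LINT x:ball 0 R|lborel. f ((R / norm x) *\<^sub>R x))"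
proof -
  let ?p = "\<lambda>x::'a. (R / norm x) *\<^sub>R x"
  have fm [measurable]: "(\<lambda>x. indicator (sphere 0 R) x *\<^sub>R f x) \<in> borel_measurable borel"
    by (intro borel_measurable_continuous_on_indicator assms) simp
  have p [measurable]: "?p \<in> borel_measurable borel"
    by measurable
  have [measurable]: "ball (0::'a) R \<in> sets borel"
    by simp
  have fp [measurable]: "(\<lambda>x. indicator (sphere 0 R) (?p x) *\<^sub>R f (?p x)) \<in> borel_measurable borel"
    by (rule measurable_compose[OF p]) measurable
  let ?d = "\<lambda>x::'a. real DIM('a) / R * indicator (ball 0 R) x"
  have "density lborel (\<lambda>x. ennreal (real DIM('a) / R) * indicator (ball 0 R) x) =
      density lborel (\<lambda>x. ennreal (?d x))"
    using assms by (intro density_cong) (auto simp: indicator_def)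
  then have "(LINT x:sphere 0 R|sphere_measure R. f x) =
      (\<integral>x. indicator (sphere 0 R) x *\<^sub>R f x \<partial>distr (density lborel (\<lambda>x. ennreal (?d x))) borel ?p)"
    unfolding set_lebesgue_integral_def sphere_measure_def by simp
  also have "\<dots> = (\<integral>x. indicator (sphere 0 R) (?p x) *\<^sub>R f (?p x) \<partial>density lborel (\<lambda>x. ennreal (?d x)))"
    by (rule integral_distr[OF _ fm]) (use p in simp)
  also have "\<dots> = (\<integral>x. ?d x *\<^sub>R (indicator (sphere 0 R) (?p x) *\<^sub>R f (?p x)) \<partial>lborel)"
    using assms fp by (intro integral_density) auto
  also have "\<dots> = (\<integral>x. (real DIM('a) / R) * (indicator (ball 0 R) x *\<^sub>R f (?p x)) \<partial>lborel)"
  proof (rule integral_cong_AE)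
    show "AE x in lborel. (real DIM('a) / R * indicator (ball 0 R) x) *\<^sub>R (indicator (sphere 0 R) (?p x) *\<^sub>R f (?p x)) =
        (real DIM('a) / R) * (indicator (ball 0 R) x *\<^sub>R f (?p x))"
      \<comment> \<open>The projection lands on the sphere except at the origin, which is a null
        set.\<close>
      using AE_lborel_singleton[of "0::'a"] by eventually_elim (use assms in auto)
  next
    show "(\<lambda>x. (real DIM('a) / R) * (indicator (ball 0 R) x *\<^sub>R f (?p x))) \<in> borel_measurable lborel"
    proof (rule borel_measurable_times[OF borel_measurable_const])
      \<comment> \<open>The origin projects to itself, off the sphere where \<open>f\<close> is
        controlled. Splitting it off as one constant value leaves a Borel function.\<close>
      have "(\<lambda>x. indicator (ball 0 R) x *\<^sub>R f (?p x)) =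
          (\<lambda>x. indicator (ball 0 R) x *\<^sub>R (if x = 0 then f 0 else indicator (sphere 0 R) (?p x) *\<^sub>R f (?p x)))"
        using assms by (auto simp: fun_eq_iff indicator_def)
      also have "\<dots> \<in> borel_measurable lborel"
        using fp by measurable
      finally show "(\<lambda>x. indicator (ball 0 R) x *\<^sub>R f (?p x)) \<in> borel_measurable lborel" .
    qed
  qed measurable
  finally show ?thesis
    using assms by (simp add: set_lebesgue_integral_def)
qed

theorem corollary2p17:
  fixes \<phi> :: "real ^ 'n \<Rightarrow> real" and R :: real
  assumes "R > 0"
    and "C_infinity_on (ball 0 R) \<phi>"
    and "continuous_on (cball 0 R) \<phi>"
  shows "(\<integral>\<^sup>+x\<in>ball 0 R. ennreal ((norm (gradient \<phi> x))\<^sup>2) \<partial>lborel) *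
         (\<integral>\<^sup>+x\<in>ball 0 R. ennreal ((norm x)\<^sup>2 * (\<phi> x)\<^sup>2) \<partial>lborel)
       \<ge> ennreal (1 / 4 *
           (real CARD('n) * (LINT x:ball 0 R|lborel. (\<phi> x)\<^sup>2)
            - R * (LINT x:sphere 0 R|sphere_measure R. (\<phi> x)\<^sup>2))\<^sup>2)"
  (is "?G * ?X \<ge> _")
proof -

  \<comment> \<open>The inequality on balls of radius r < R\<close>
  let ?f = "\<lambda>x. (\<phi> x)\<^sup>2"
  let ?g = "\<lambda>x. (2 * \<phi> x) *\<^sub>R gradient \<phi> x"
  define n where "n = real CARD('n)"
  note grad = GDERIV_gradient_C_infinity_on[OF assms(2) open_ball]
  note cgrad = continuous_on_gradient_C_infinity_on[OF assms(2) open_ball]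
  have c\<phi>: "continuous_on (ball 0 R) \<phi>"
    using assms(3) by (rule continuous_on_subset) auto
  have f: "GDERIV ?f x :> ?g x" if "x \<in> ball 0 R" for x
    by (rule GDERIV_DERIV_compose[OF grad[OF that], of "\<lambda>y. y\<^sup>2" "2 * \<phi> x"])
       (auto intro!: derivative_eq_intros)
  have g: "continuous_on (ball 0 R) ?g"
    by (intro continuous_intros c\<phi> cgrad)
  \<comment> \<open>Cauchy-Schwarz is applied to \<open>u\<close> and \<open>v\<close> as
    nonnegative extended integrals, so it also covers an infinite Dirichlet integral.\<close>
  define u where "u x = indicator (ball 0 R) x *\<^sub>R norm (gradient \<phi> x)" for x
  define v where "v x = indicator (ball 0 R) x *\<^sub>R (norm x * \<bar>\<phi> x\<bar>)" for x
  have [measurable]: "u \<in> borel_measurable borel" "v \<in> borel_measurable borel"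
    unfolding u_def[abs_def] v_def[abs_def]
    by (intro borel_measurable_continuous_on_indicator continuous_intros c\<phi> cgrad; simp)+
  \<comment> \<open>By the divergence theorem this is minus the integral of
    \<open>x \<bullet> ?g x\<close> over the closed ball of radius r; the second term stands for r
    times the surface integral.\<close>
  define A where "A r = n * (LINT x:cball 0 r|lborel. ?f x) -
      n * (LINT x:cball 0 r|lborel. ?f ((r / norm x) *\<^sub>R x))" for r
  have bound: "ennreal (1 / 4 * (A r)\<^sup>2) \<le> ?G * ?X" if r: "0 < r" "r < R" for r
  proof -
    have cball: "cball 0 r \<subseteq> ball (0::real^'n) R"
      using r by auto
    define w where "w x = indicator (cball 0 r) x *\<^sub>R (x \<bullet> ?g x)" for x
    have w: "integrable lborel w"
      unfolding w_def[abs_def]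
      by (intro borel_integrable_compact continuous_intros
          continuous_on_subset[OF c\<phi> cball] continuous_on_subset[OF cgrad cball]) auto
    have "A r = - (\<integral>x. w x \<partial>lborel)"
      using radial_divergence_theorem[OF r f g]
      by (simp add: A_def n_def w_def[abs_def] set_lebesgue_integral_def)
    then have "ennreal \<bar>A r\<bar> \<le> (\<integral>\<^sup>+x. ennreal (norm (w x)) \<partial>lborel)"
      using integral_norm_bound_ennreal[OF w] by simp
    also have "\<dots> \<le> (\<integral>\<^sup>+x. ennreal 2 * (ennreal (u x) * ennreal (v x)) \<partial>lborel)"
    proof (rule nn_integral_mono)
      fix x
      have "norm (w x) \<le> 2 * (u x * v x)"
      proof (cases "x \<in> cball 0 r")
        case True
        then have "norm (w x) = 2 * \<bar>\<phi> x\<bar> * \<bar>x \<bullet> gradient \<phi> x\<bar>"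
          by (simp add: w_def abs_mult)
        also have "\<dots> \<le> 2 * \<bar>\<phi> x\<bar> * (norm x * norm (gradient \<phi> x))"
          by (intro mult_left_mono Cauchy_Schwarz_ineq2) auto
        also have "\<dots> = 2 * (u x * v x)"
          using True cball by (auto simp: u_def v_def)
        finally show ?thesis .
      qed (auto simp: w_def u_def v_def)
      then have "ennreal (norm (w x)) \<le> ennreal (2 * (u x * v x))"
        by (rule ennreal_leI)
      then show "ennreal (norm (w x)) \<le> ennreal 2 * (ennreal (u x) * ennreal (v x))"
        by (simp add: ennreal_mult u_def v_def)
    qed
    also have "\<dots> = ennreal 2 * (\<integral>\<^sup>+x. ennreal (u x) * ennreal (v x) \<partial>lborel)"
      by (rule nn_integral_cmult) measurable
    \<comment> \<open>The factor 1/2 cancels the 2 in the gradient 2\<phi>\<nabla>\<phi> of the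
      square; after squaring it becomes the constant 1/4.\<close>
    finally have "(ennreal (1 / 2) * ennreal \<bar>A r\<bar>)\<^sup>2 \<le>
        (ennreal (1 / 2) * (ennreal 2 * (\<integral>\<^sup>+x. ennreal (u x) * ennreal (v x) \<partial>lborel)))\<^sup>2"
      by (intro power_mono mult_left_mono) auto
    also have "ennreal (1 / 2) * (ennreal 2 * (\<integral>\<^sup>+x. ennreal (u x) * ennreal (v x) \<partial>lborel)) =
        (\<integral>\<^sup>+x. ennreal (u x) * ennreal (v x) \<partial>lborel)"
      unfolding mult.assoc[symmetric] by (subst ennreal_mult[symmetric]) auto
    also have "(\<integral>\<^sup>+x. ennreal (u x) * ennreal (v x) \<partial>lborel)\<^sup>2 \<le>
        (\<integral>\<^sup>+x. (ennreal (u x))\<^sup>2 \<partial>lborel) * (\<integral>\<^sup>+x. (ennreal (v x))\<^sup>2 \<partial>lborel)"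
      by (rule Cauchy_Schwarz_nn_integral) measurable
    also have "(\<integral>\<^sup>+x. (ennreal (u x))\<^sup>2 \<partial>lborel) = ?G"
      by (intro nn_integral_cong) (simp add: u_def indicator_def ennreal_power)
    also have "(\<integral>\<^sup>+x. (ennreal (v x))\<^sup>2 \<partial>lborel) = ?X"
      by (intro nn_integral_cong) (simp add: v_def indicator_def ennreal_power power_mult_distrib)
    also have "(ennreal (1 / 2) * ennreal \<bar>A r\<bar>)\<^sup>2 = ennreal ((1 / 2 * \<bar>A r\<bar>)\<^sup>2)"
      by (subst ennreal_mult[symmetric]) (auto simp: ennreal_power simp del: times_divide_eq_left)
    also have "(1 / 2 * \<bar>A r\<bar>)\<^sup>2 = 1 / 4 * (A r)\<^sup>2"
      by (simp add: power_divide)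
    finally show ?thesis .
  qed

  \<comment> \<open>Passage to the limit r \<rightarrow> R\<close>
  define L where "L = n * (LINT x:ball 0 R|lborel. ?f x) -
      n * (LINT x:ball 0 R|lborel. ?f ((R / norm x) *\<^sub>R x))"
  \<comment> \<open>The shifted indices make every radius strictly positive and strictly below R,
    starting with R / 2.\<close>
  define \<rho> where "\<rho> k = R * (real (Suc k) / real (Suc (Suc k)))" for k
  have \<rho>: "0 < \<rho> k" "\<rho> k < R" for k
    using assms(1) by (auto simp: \<rho>_def field_simps intro: add_pos_nonneg)
  have \<rho>_lim: "\<rho> \<longlonglongrightarrow> R"
  proof -
    have "(\<lambda>k. R * (real (Suc k) / real (Suc (Suc k)))) \<longlonglongrightarrow> R * 1"
      using LIMSEQ_Suc[OF LIMSEQ_n_over_Suc_n] by (intro tendsto_mult tendsto_const)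
    then show ?thesis
      by (simp add: \<rho>_def[abs_def])
  qed
  obtain B where B: "\<And>x. x \<in> cball 0 R \<Longrightarrow> norm (?f x) \<le> B"
  proof -
    have "bounded (?f ` cball 0 R)"
      by (intro compact_imp_bounded compact_continuous_image continuous_intros assms(3)) simp
    then obtain B where "\<forall>y\<in>?f ` cball 0 R. norm y \<le> B"
      unfolding bounded_iff by blast
    then show ?thesis
      by (intro that[of B]) blast
  qed
  have "B \<ge> 0"
    using order_trans[OF norm_ge_zero B[of 0]] assms(1) by simp
  \<comment> \<open>Extension by zero gives a Borel function on the whole space, so that
    compositions with \<open>p k\<close> and \<open>q\<close> are measurable.\<close>
  define \<Phi> where "\<Phi> x = indicator (cball 0 R) x *\<^sub>R ?f x" for x
  have [measurable]: "\<Phi> \<in> borel_measurable borel"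
    unfolding \<Phi>_def[abs_def]
    by (intro borel_measurable_continuous_on_indicator continuous_intros assms(3)) simp
  have [measurable]: "ball (0::real^'n) s \<in> sets borel" "cball (0::real^'n) s \<in> sets borel" for s
    by simp_all
  \<comment> \<open>A common form for both limits: \<open>p k\<close> is either the projection to
    radius \<open>\<rho> k\<close> or the identity. The bound \<open>B\<close> on the closed ball of
    radius R is the dominating function.\<close>
  have lim: "(\<lambda>k. LINT x:cball 0 (\<rho> k)|lborel. ?f (p k x)) \<longlonglongrightarrow> (LINT x:ball 0 R|lborel. ?f (q x))"
    if [measurable]: "\<And>k. p k \<in> borel_measurable borel" "q \<in> borel_measurable borel"
      and p: "\<And>k x. x \<in> cball 0 (\<rho> k) \<Longrightarrow> p k x \<in> cball 0 R"
      and q: "\<And>x. x \<in> ball 0 R \<Longrightarrow> q x \<in> cball 0 R"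
      and pq: "\<And>x. x \<in> ball 0 R \<Longrightarrow> (\<lambda>k. p k x) \<longlonglongrightarrow> q x"
    for p :: "nat \<Rightarrow> real^'n \<Rightarrow> real^'n" and q
    unfolding set_lebesgue_integral_def
  proof (rule integral_dominated_convergence[where w = "\<lambda>x. indicator (cball 0 R) x *\<^sub>R B"])
    have "(\<lambda>x. indicator (ball 0 R) x *\<^sub>R ?f (q x)) = (\<lambda>x. indicator (ball 0 R) x *\<^sub>R \<Phi> (q x))"
      using q by (auto simp: \<Phi>_def indicator_def fun_eq_iff)
    also have "\<dots> \<in> borel_measurable lborel"
      by measurable
    finally show "(\<lambda>x. indicator (ball 0 R) x *\<^sub>R ?f (q x)) \<in> borel_measurable lborel" .
  next
    fix k
    have "(\<lambda>x. indicator (cball 0 (\<rho> k)) x *\<^sub>R ?f (p k x)) =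
        (\<lambda>x. indicator (cball 0 (\<rho> k)) x *\<^sub>R \<Phi> (p k x))"
      using p by (auto simp: \<Phi>_def indicator_def fun_eq_iff)
    also have "\<dots> \<in> borel_measurable lborel"
      by measurable
    finally show "(\<lambda>x. indicator (cball 0 (\<rho> k)) x *\<^sub>R ?f (p k x)) \<in> borel_measurable lborel" .
  next
    show "integrable lborel (\<lambda>x::real^'n. indicator (cball 0 R) x *\<^sub>R B)"
      by (intro borel_integrable_compact) auto
  next
    fix k
    have "norm (indicator (cball 0 (\<rho> k)) x *\<^sub>R ?f (p k x)) \<le> indicator (cball 0 R) x *\<^sub>R B" for x
    proof (cases "x \<in> cball 0 (\<rho> k)")
      case True
      then show ?thesis
        using B[OF p[OF True]] \<rho>[of k] by auto
    qed (use \<open>B \<ge> 0\<close> in \<open>auto simp: indicator_def\<close>)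
    then show "AE x in lborel. norm (indicator (cball 0 (\<rho> k)) x *\<^sub>R ?f (p k x)) \<le> indicator (cball 0 R) x *\<^sub>R B"
      by simp
  next
    \<comment> \<open>The closed balls exhaust the open ball: an interior point eventually lies in
      them, and a point with norm at least R never does.\<close>
    have "(\<lambda>k. indicator (cball 0 (\<rho> k)) x *\<^sub>R ?f (p k x)) \<longlonglongrightarrow> indicator (ball 0 R) x *\<^sub>R ?f (q x)" for x
    proof (cases "x \<in> ball 0 R")
      case True
      then have "\<forall>\<^sub>F k in sequentially. norm x < \<rho> k"
        using order_tendstoD(1)[OF \<rho>_lim] by simp
      then have ev: "\<forall>\<^sub>F k in sequentially. x \<in> cball 0 (\<rho> k)"
        by eventually_elim auto
      then have "\<forall>\<^sub>F k in sequentially. p k x \<in> cball 0 R"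
        by eventually_elim (rule p)
      then have "(\<lambda>k. \<phi> (p k x)) \<longlonglongrightarrow> \<phi> (q x)"
        by (rule continuous_on_tendsto_compose[OF assms(3) pq[OF True] q[OF True]])
      then have "(\<lambda>k. ?f (p k x)) \<longlonglongrightarrow> indicator (ball 0 R) x *\<^sub>R ?f (q x)"
        using True by (auto intro: tendsto_power)
      then show ?thesis
        by (rule Lim_transform_eventually) (use ev in eventually_elim, simp)
    next
      case False
      then have "x \<notin> cball 0 (\<rho> k)" for k
        using \<rho>[of k] by auto
      with False show ?thesis
        by simp
    qed
    then show "AE x in lborel. (\<lambda>k. indicator (cball 0 (\<rho> k)) x *\<^sub>R ?f (p k x)) \<longlonglongrightarrow>
        indicator (ball 0 R) x *\<^sub>R ?f (q x)"
      by simp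
  qed
  have proj: "norm ((s / norm x) *\<^sub>R x) \<le> R" if "0 < s" "s \<le> R" for s and x :: "real^'n"
    using that by (cases "x = 0") auto
  have "(\<lambda>k. LINT x:cball 0 (\<rho> k)|lborel. ?f ((\<rho> k / norm x) *\<^sub>R x))
      \<longlonglongrightarrow> (LINT x:ball 0 R|lborel. ?f ((R / norm x) *\<^sub>R x))"
  proof (rule lim)
    show "(\<lambda>k. (\<rho> k / norm x) *\<^sub>R x) \<longlonglongrightarrow> (R / norm x) *\<^sub>R x" for x :: "real^'n"
      \<comment> \<open>As a product with a fixed factor the limit also covers x = 0, where the
        quotient rule would fail.\<close>
      unfolding divide_inverse by (intro tendsto_intros \<rho>_lim)
    show "(\<rho> k / norm x) *\<^sub>R x \<in> cball 0 R" for k and x :: "real^'n"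
      using proj[of "\<rho> k" x] \<rho>[of k] by simp
    show "(R / norm x) *\<^sub>R x \<in> cball 0 R" for x :: "real^'n"
      using proj[of R x] assms(1) by simp
  qed measurable
  moreover have "(\<lambda>k. LINT x:cball 0 (\<rho> k)|lborel. ?f x) \<longlonglongrightarrow> (LINT x:ball 0 R|lborel. ?f x)"
  proof (rule lim)
    show "x \<in> cball 0 R" if "x \<in> cball 0 (\<rho> k)" for k and x :: "real^'n"
      using that \<rho>[of k] by simp
  qed auto
  ultimately have "(\<lambda>k. A (\<rho> k)) \<longlonglongrightarrow> L"
    unfolding A_def L_def by (intro tendsto_intros)
  then have "(\<lambda>k. ennreal (1 / 4 * (A (\<rho> k))\<^sup>2)) \<longlonglongrightarrow> ennreal (1 / 4 * L\<^sup>2)"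
    by (intro tendsto_ennrealI tendsto_intros)
  \<comment> \<open>The upper bound is already taken over the full ball and does not depend on the
    radius, so it survives the limit.\<close>
  then have "ennreal (1 / 4 * L\<^sup>2) \<le> ?G * ?X"
    by (rule LIMSEQ_le_const2) (use bound[OF \<rho>] in blast)
  moreover have "R * (LINT x:sphere 0 R|sphere_measure R. ?f x) =
      n * (LINT x:ball 0 R|lborel. ?f ((R / norm x) *\<^sub>R x))"
    using set_integral_sphere_measure[of R ?f] assms(1)
      continuous_on_power[OF continuous_on_subset[OF assms(3) sphere_cball]]
    by (simp add: n_def)
  ultimately show ?thesis
    by (simp add: L_def n_def)
qed

end
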